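(* In Version B, the $\mathcal{P}$-positions with exactly $4$ (nonempty) piles are precisely the positions of one of the following forms (the order of the piles is irrelevant): \begin{itemize} \item $1, 1, e_2, e_2$; \item $e_2, e_2, e_2, e_2$; \item $e_2, o_3, o_3, o_3$. \end{itemize}
   Context: Version B is a two-player impartial game. A position consists of finitely many piles of tokens; empty piles are ignored. The players alternate turns; on a turn, a player either removes a single token from any one nonempty pile, or removes one token from each (nonempty) pile. The last player to move wins. A position is a $\mathcal{P}$-position if the player who is not about to move has a winning strategy, equivalently if none of its options (positions reachable in one move) is a $\mathcal{P}$-position; otherwise it is an $\mathcal{N}$-position. A position is written as the list of its pile sizes. Notation: $e_k$ (respectively $o_k$) denotes any even (respectively odd) pile of size at least $k$; different occurrences of the same symbol in a list may stand for different sizes. *)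

theory Defs
  imports "HOL-Library.Multiset"
begin

text \<open>
  A position is the multiset of its pile sizes.  Empty piles are ignored, so a (normalized)
  position contains no \<open>0\<close>, and every move discards the piles that it empties.
\<close>

definition position :: "nat multiset \<Rightarrow> bool" where
  "position p \<longleftrightarrow> 0 \<notin># p"

definition nonempty_piles :: "nat multiset \<Rightarrow> nat multiset" where
  "nonempty_piles p = filter_mset (\<lambda>n. 0 < n) p"

inductive move :: "nat multiset \<Rightarrow> nat multiset \<Rightarrow> bool" where
  one_pile: "\<lbrakk>n \<in># p; 0 < n\<rbrakk> \<Longrightarrow> move p (nonempty_piles (add_mset (n - 1) (p - {#n#})))"
| all_piles: "nonempty_piles p \<noteq> {#} \<Longrightarrow>
    move p (nonempty_piles (image_mset (\<lambda>n. n - 1) (nonempty_piles p)))"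

text \<open>
  Under normal play, \<open>N_position\<close> says that the player about to move can force a win and
  \<open>P_position\<close> that the other player can.  Both are least fixed points; the lemmas
  \<open>P_position_iff\<close> and \<open>N_position_iff\<close> below show that they are complementary and
  satisfy the usual recursion.
\<close>

inductive P_position :: "nat multiset \<Rightarrow> bool" and N_position :: "nat multiset \<Rightarrow> bool" where
  P: "(\<And>q. move p q \<Longrightarrow> N_position q) \<Longrightarrow> P_position p"
| N: "\<lbrakk>move p q; P_position q\<rbrakk> \<Longrightarrow> N_position p"

definition even_ge :: "nat \<Rightarrow> nat set" where
  "even_ge k = {n. even n \<and> k \<le> n}"

definition odd_ge :: "nat \<Rightarrow> nat set" where
  "odd_ge k = {n. odd n \<and> k \<le> n}"

lemma sum_nonempty_piles [simp]: "\<Sum>\<^sub># (nonempty_piles p) = \<Sum>\<^sub># p"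
  unfolding nonempty_piles_def by (induction p) auto

lemma position_nonempty_piles [simp]: "position (nonempty_piles p)"
  by (simp add: position_def nonempty_piles_def)

lemma position_move: "move p q \<Longrightarrow> position q"
  by (induction rule: move.induct) (rule position_nonempty_piles)+

lemma sum_pred_less:
  "\<lbrakk>position p; p \<noteq> {#}\<rbrakk> \<Longrightarrow> (\<Sum>n\<in>#p. n - 1) < \<Sum>\<^sub># p"
proof (induction p)
  case (add x p)
  then show ?case by (cases "p = {#}") (auto simp: position_def intro: add_less_mono)
qed simp

lemma move_decreases: "move p q \<Longrightarrow> \<Sum>\<^sub># q < \<Sum>\<^sub># p"
proof (induction rule: move.induct)
  case (one_pile n p)
  then show ?case by (auto dest!: multi_member_split)
next
  case (all_piles p)
  from sum_pred_less[OF position_nonempty_piles all_piles] show ?case by simp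
qed

lemma N_position_iff_ex: "N_position p \<longleftrightarrow> (\<exists>q. move p q \<and> P_position q)"
  by (meson N_position.cases P_position_N_position.N)

lemma P_position_iff_all: "P_position p \<longleftrightarrow> (\<forall>q. move p q \<longrightarrow> N_position q)"
  by (meson P_position.cases P_position_N_position.P)

lemma N_position_iff: "N_position p \<longleftrightarrow> \<not> P_position p"
proof (induction "\<Sum>\<^sub># p" arbitrary: p rule: less_induct)
  case less
  have "N_position q \<longleftrightarrow> \<not> P_position q" if "move p q" for q
    using less move_decreases[OF that] by blast
  then show ?case
    using N_position_iff_ex[of p] P_position_iff_all[of p] by blast
qed

lemma P_position_iff: "P_position p \<longleftrightarrow> (\<forall>q. move p q \<longrightarrow> \<not> P_position q)"
  using P_position_iff_all N_position_iff by blast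

end

theory Submission
  imports Defs
begin

text \<open>Carries the game recursion over to multisets that may contain \<open>0\<close>, so that
  emptied piles need not be discarded after each move. Normalizing before or after a move gives the
  same result.\<close>

lemma P_position_nonempty_piles_iff:
  "P_position (nonempty_piles p) \<longleftrightarrow>
    (\<forall>n\<in>#p. 0 < n \<longrightarrow> \<not> P_position (nonempty_piles (add_mset (n - 1) (p - {#n#})))) \<and>
    ((\<exists>n\<in>#p. 0 < n) \<longrightarrow> \<not> P_position (nonempty_piles (image_mset (\<lambda>n. n - 1) p)))"
proof -
  have one: "nonempty_piles (add_mset (n - 1) (nonempty_piles p - {#n#})) =
      nonempty_piles (add_mset (n - 1) (p - {#n#}))" if "0 < n" for n
    using that by (simp add: nonempty_piles_def multiset_eq_iff)
  have idem: "nonempty_piles (nonempty_piles p) = nonempty_piles p"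
    by (simp add: nonempty_piles_def multiset_eq_iff)
  \<comment> \<open>Natural subtraction is truncated: an empty pile is sent to
    \<open>0 - 1 = 0\<close>, which the outer filter removes anyway.\<close>
  have all: "nonempty_piles (image_mset (\<lambda>n. n - 1) (nonempty_piles p)) =
      nonempty_piles (image_mset (\<lambda>n. n - 1) p)"
    unfolding nonempty_piles_def by (induction p) auto
  have mem: "n \<in># nonempty_piles p \<longleftrightarrow> n \<in># p \<and> 0 < n" for n
    by (simp add: nonempty_piles_def)
  have ne: "nonempty_piles p \<noteq> {#} \<longleftrightarrow> (\<exists>n\<in>#p. 0 < n)"
    unfolding set_mset_eq_empty_iff[symmetric] using mem by blast
  have "move r q \<longleftrightarrow> (\<exists>n\<in>#r. 0 < n \<and> q = nonempty_piles (add_mset (n - 1) (r - {#n#}))) \<or>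
      nonempty_piles r \<noteq> {#} \<and> q = nonempty_piles (image_mset (\<lambda>n. n - 1) (nonempty_piles r))" for r q
    by (subst move.simps) blast
  from this[of "nonempty_piles p"] have move_iff: "move (nonempty_piles p) q \<longleftrightarrow>
      (\<exists>n\<in>#p. 0 < n \<and> q = nonempty_piles (add_mset (n - 1) (p - {#n#}))) \<or>
      (\<exists>n\<in>#p. 0 < n) \<and> q = nonempty_piles (image_mset (\<lambda>n. n - 1) p)" for q
    unfolding idem all ne Bex_def mem using one by (auto simp del: One_nat_def)
  show ?thesis
    by (subst P_position_iff, unfold move_iff) auto
qed

text \<open>
  Keeping emptied piles as entries \<open>0\<close> makes all positions with at most four piles multisets
  of size four, so one predicate covers them: with two or fewer piles the cold positions
  have only even piles, with three piles those of even sum.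
\<close>

definition cold :: "nat multiset \<Rightarrow> bool" where
  "cold p \<longleftrightarrow> (let k = size (filter_mset odd p) in
     k = 0 \<or>
     k = 2 \<and> (count p 0 = 1 \<or> count p 0 = 0 \<and> count p 1 = 2) \<or>
     k = 3 \<and> count p 0 = 0 \<and> count p 1 = 0)"

lemma size_mset_eq_Suc_iff: "size p = Suc n \<longleftrightarrow> (\<exists>a q. p = add_mset a q \<and> size q = n)"
  by (metis add_diff_cancel_left' plus_1_eq_Suc size_add_mset size_eq_Suc_imp_eq_union)

text \<open>This and the next two lemmas delete a displayed pile by its place in the list, which
  avoids case splits on whether some piles have equal size.\<close>

lemma add_mset_remove_second: "add_mset a (add_mset b p) - {#b#} = add_mset a p"
  by (metis add_mset_commute add_mset_remove_trivial)

lemma add_mset_remove_third: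
  "add_mset a (add_mset b (add_mset c p)) - {#c#} = add_mset a (add_mset b p)"
  by (metis add_mset_commute add_mset_remove_trivial)

lemma add_mset_remove_fourth:
  "add_mset a (add_mset b (add_mset c (add_mset d p))) - {#d#} = add_mset a (add_mset b (add_mset c p))"
  by (metis add_mset_commute add_mset_remove_trivial)

text \<open>Puts the recursion into the same shape as \<open>cold_four_iff\<close>, conjunct by
  conjunct, so that the two can be compared by congruence.\<close>

lemma P_position_four_iff:
  "P_position (nonempty_piles {#a, b, c, d#}) \<longleftrightarrow>
    (0 < a \<longrightarrow> \<not> P_position (nonempty_piles {#a - 1, b, c, d#})) \<and>
    (0 < b \<longrightarrow> \<not> P_position (nonempty_piles {#b - 1, a, c, d#})) \<and>
    (0 < c \<longrightarrow> \<not> P_position (nonempty_piles {#c - 1, a, b, d#})) \<and>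
    (0 < d \<longrightarrow> \<not> P_position (nonempty_piles {#d - 1, a, b, c#})) \<and>
    (0 < a \<or> 0 < b \<or> 0 < c \<or> 0 < d \<longrightarrow>
      \<not> P_position (nonempty_piles {#a - 1, b - 1, c - 1, d - 1#}))"
  unfolding P_position_nonempty_piles_iff[of "{#a, b, c, d#}"]
  by (simp only: set_mset_add_mset_insert set_mset_empty ball_simps bex_simps simp_thms
      add_mset_remove_trivial add_mset_remove_second add_mset_remove_third add_mset_remove_fourth
      image_mset_add_mset image_mset_empty conj_assoc)

text \<open>Membership in \<open>cold\<close> depends only on the parities of the entries and on
  which of them are \<open>0\<close> or \<open>1\<close>, so finitely many types of piles have to be
  checked.\<close>

lemma cold_four_iff:
  "cold {#a, b, c, d#} \<longleftrightarrow>
    (0 < a \<longrightarrow> \<not> cold {#a - 1, b, c, d#}) \<and>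
    (0 < b \<longrightarrow> \<not> cold {#b - 1, a, c, d#}) \<and>
    (0 < c \<longrightarrow> \<not> cold {#c - 1, a, b, d#}) \<and>
    (0 < d \<longrightarrow> \<not> cold {#d - 1, a, b, c#}) \<and>
    (0 < a \<or> 0 < b \<or> 0 < c \<or> 0 < d \<longrightarrow> \<not> cold {#a - 1, b - 1, c - 1, d - 1#})"
proof -
  \<comment> \<open>Each case settles whether \<open>n\<close> is \<open>0\<close> and the parities
    of \<open>n\<close> and \<open>n - 1\<close>. Then \<open>n - 1\<close> cannot be
    \<open>1\<close> if \<open>k\<close> is even, nor \<open>0\<close> if \<open>k\<close> is odd;
    whether \<open>k\<close> is \<open>0\<close> or \<open>1\<close>, respectively, is left to
    \<open>simp\<close>.\<close>
  have "n = 0 \<or> (\<exists>k. n = Suc k \<and> even k \<and> k \<noteq> Suc 0) \<or> (\<exists>k. n = Suc k \<and> odd k \<and> 0 < k)" for n :: nat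
    by (cases n) (auto intro: odd_pos)
  from this[of a] this[of b] this[of c] this[of d] show ?thesis
    unfolding cold_def Let_def by (elim disjE exE conjE; simp)
qed

text \<open>Both predicates obey the same recursion, whose options have fewer tokens in total, so
  they agree by strong induction on that total.\<close>

lemma P_position_four_iff_cold: "P_position (nonempty_piles {#a, b, c, d#}) \<longleftrightarrow> cold {#a, b, c, d#}"
proof (induction "a + b + c + d" arbitrary: a b c d rule: less_induct)
  case less
  show ?case
    unfolding P_position_four_iff[of a b c d] cold_four_iff[of a b c d]
    \<comment> \<open>\<open>imp_cong\<close> supplies the guard of each conjunct; a positive pile
      is what makes the total drop, as the induction hypothesis requires.\<close>
    by (intro arg_cong2[of _ _ _ _ "(\<and>)"] imp_cong refl arg_cong[of _ _ Not] less) auto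
qed

theorem lemma2p4:
  fixes p :: "nat multiset"
  assumes "position p" and "size p = 4"
  shows "P_position p \<longleftrightarrow>
      (\<exists>a\<in>even_ge 2. \<exists>b\<in>even_ge 2. p = {#1, 1, a, b#})
    \<or> (\<exists>a\<in>even_ge 2. \<exists>b\<in>even_ge 2. \<exists>c\<in>even_ge 2. \<exists>d\<in>even_ge 2. p = {#a, b, c, d#})
    \<or> (\<exists>a\<in>even_ge 2. \<exists>b\<in>odd_ge 3. \<exists>c\<in>odd_ge 3. \<exists>d\<in>odd_ge 3. p = {#a, b, c, d#})"
    (is "_ \<longleftrightarrow> ?R")
proof -
  let ?E = "filter_mset even p" and ?O = "filter_mset odd p"
  have p: "p = ?E + ?O" by (rule multiset_partition)
  then have sz: "size ?E + size ?O = 4" using assms(2) by (metis size_union)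
  have count_0: "count p 0 = 0"
    using assms(1) by (simp add: position_def not_in_iff)
  have E: "n \<in> even_ge 2" if "n \<in># ?E" for n
  proof -
    have "n \<noteq> 0" using that assms(1) by (metis multiset_filter_subset mset_subset_eqD position_def)
    then show ?thesis using that by (auto simp: even_ge_def elim!: evenE)
  qed
  have O: "n \<in> odd_ge 3" if "n \<in># ?O" "count p 1 = 0" for n
  proof -
    have "n \<noteq> 1" using that by (auto simp: count_eq_zero_iff)
    then show ?thesis using that by (auto simp: odd_ge_def elim!: oddE)
  qed
  obtain a b c d where abcd: "p = {#a, b, c, d#}"
    using assms(2) by (auto simp: eval_nat_numeral size_mset_eq_Suc_iff)
  have "nonempty_piles p = p"
    using assms(1) by (auto simp: nonempty_piles_def position_def filter_mset_eq_conv intro: gr0I)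
  then have "P_position p \<longleftrightarrow> cold p"
    using P_position_four_iff_cold[of a b c d] abcd by simp
  \<comment> \<open>Without empty piles, the disjunct of \<open>cold\<close> for three-pile
    positions disappears.\<close>
  also have "\<dots> \<longleftrightarrow> size ?O = 0 \<or> size ?O = 2 \<and> count p 1 = 2 \<or> size ?O = 3 \<and> count p 1 = 0"
    by (simp add: cold_def Let_def count_0)
  also have "\<dots> \<longleftrightarrow> ?R"
  proof (intro iffI; elim disjE)
    assume "size ?O = 0"
    then have "?E = p" by (auto simp: filter_mset_eq_conv)
    then have "a \<in> even_ge 2" "b \<in> even_ge 2" "c \<in> even_ge 2" "d \<in> even_ge 2"
      using E abcd by simp_all
    then show ?R using abcd by blast
  next
    assume e: "size ?O = 2 \<and> count p 1 = 2"
    then obtain m n where mn: "?O = {#m, n#}"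
      by (auto simp: eval_nat_numeral size_mset_eq_Suc_iff)
    have "size ?E = 2" using e sz by simp
    then obtain k l where kl: "?E = {#k, l#}"
      by (auto simp: eval_nat_numeral size_mset_eq_Suc_iff)
    \<comment> \<open>Both piles of size \<open>1\<close> are odd, so they exhaust the two odd
      piles.\<close>
    have "count ?O 1 = 2" using e by simp
    then have "m = 1 \<and> n = 1" unfolding mn by (auto split: if_splits)
    then have "p = {#1, 1, k, l#}" using p kl mn by simp
    moreover have "k \<in> even_ge 2" "l \<in> even_ge 2"
      using E kl by simp_all
    ultimately show ?R by blast
  next
    assume e: "size ?O = 3 \<and> count p 1 = 0"
    then obtain l m n where lmn: "?O = {#l, m, n#}"
      by (auto simp: eval_nat_numeral size_mset_eq_Suc_iff)
    have "size ?E = 1" using e sz by simp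
    then obtain k where k: "?E = {#k#}"
      by (auto simp: eval_nat_numeral size_mset_eq_Suc_iff)
    have "p = {#k, l, m, n#}" using p k lmn by simp
    moreover have "k \<in> even_ge 2" "l \<in> odd_ge 3" "m \<in> odd_ge 3" "n \<in> odd_ge 3"
      using E O e k lmn by auto
    ultimately show ?R by blast
  qed (auto simp: even_ge_def odd_ge_def)
  finally show ?thesis .
qed

end
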